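(* For all integers $j, m, n$ with $m \geq 4$, $j \geq m+1$ and $n \geq 3$, \[ m_j(K_m, nK_2) \geq \left\lceil \frac{2n}{j+2-m} \right\rceil . \]
   Context: All graphs are finite, simple and undirected. $K_m$ is the complete graph on $m$ vertices and $nK_2$ is a set of $n$ pairwise vertex-disjoint edges (a matching of size $n$). $K_{j\times t}$ denotes the complete multipartite graph with $j$ partite sets, each having $t$ vertices. For graphs $G_1,G_2$, the multipartite Ramsey number $m_j(G_1,G_2)$ is the smallest positive integer $t$ such that for every 2-edge-coloring $(G^1,G^2)$ of $K_{j\times t}$ (that is, every partition of the edge set into two color classes, $G^i$ being the spanning subgraph formed by the edges of color $i$), $G^i$ contains a copy of $G_i$ as a (not necessarily induced) subgraph for at least one $i\in\{1,2\}$. *)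

theory Defs
  imports Complex_Main
begin

text \<open>A finite simple undirected graph is a pair of a vertex set and a set of two-element
  vertex sets.\<close>

type_synonym 'a ugraph = "'a set \<times> 'a set set"

abbreviation verts :: "'a ugraph \<Rightarrow> 'a set" where
  "verts G \<equiv> fst G"

abbreviation edges :: "'a ugraph \<Rightarrow> 'a set set" where
  "edges G \<equiv> snd G"

definition simple_graph :: "'a ugraph \<Rightarrow> bool" where
  "simple_graph G \<longleftrightarrow> finite (verts G) \<and> (\<forall>e\<in>edges G. e \<subseteq> verts G \<and> card e = 2)"

text \<open>Not necessarily induced: non-edges of \<open>H\<close> may be mapped to edges of \<open>G\<close>.\<close>

definition contains_copy :: "'a ugraph \<Rightarrow> 'b ugraph \<Rightarrow> bool" where
  "contains_copy G H \<longleftrightarrow>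
     (\<exists>f. inj_on f (verts H) \<and> f ` verts H \<subseteq> verts G \<and> (\<forall>e\<in>edges H. f ` e \<in> edges G))"

definition complete_graph :: "nat \<Rightarrow> nat ugraph" where
  "complete_graph m = ({..<m}, {{u, v} | u v. u < m \<and> v < m \<and> u \<noteq> v})"

definition matching_graph :: "nat \<Rightarrow> nat ugraph" where
  "matching_graph n = ({..<2 * n}, {{2 * i, 2 * i + 1} | i. i < n})"

text \<open>The vertex \<open>(p, a)\<close> is the \<open>a\<close>-th vertex of the \<open>p\<close>-th partite set.\<close>

definition complete_multipartite :: "nat \<Rightarrow> nat \<Rightarrow> (nat \<times> nat) ugraph" where
  "complete_multipartite j t =
     ({..<j} \<times> {..<t},
      {{(p, a), (q, b)} | p a q b. p < j \<and> q < j \<and> a < t \<and> b < t \<and> p \<noteq> q})"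

lemma simple_graph_complete_graph: "simple_graph (complete_graph m)"
  by (auto simp: simple_graph_def complete_graph_def)

lemma simple_graph_matching_graph: "simple_graph (matching_graph n)"
  by (auto simp: simple_graph_def matching_graph_def)

lemma simple_graph_complete_multipartite: "simple_graph (complete_multipartite j t)"
  by (auto simp: simple_graph_def complete_multipartite_def)

text \<open>A colour class may be empty.\<close>

definition two_edge_colouring :: "'a ugraph \<Rightarrow> 'a ugraph \<Rightarrow> 'a ugraph \<Rightarrow> bool" where
  "two_edge_colouring G R B \<longleftrightarrow>
     verts R = verts G \<and> verts B = verts G \<and>
     edges R \<union> edges B = edges G \<and> edges R \<inter> edges B = {}"

text \<open>The value is unspecified if no suitable \<open>t\<close> exists. For \<open>G1 = complete_graph m\<close>,
  \<open>G2 = matching_graph n\<close> and \<open>m \<le> j\<close> a suitable \<open>t\<close> always exists: if the second colour has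
  no matching of size \<open>n\<close>, its edges are covered by at most \<open>2 * (n - 1)\<close> vertices, so for
  large \<open>t\<close> every partite set has a vertex outside the cover.\<close>

definition multipartite_ramsey :: "nat \<Rightarrow> 'a ugraph \<Rightarrow> 'b ugraph \<Rightarrow> nat" where
  "multipartite_ramsey j G1 G2 =
     (LEAST t. t > 0 \<and>
        (\<forall>R B. two_edge_colouring (complete_multipartite j t) R B \<longrightarrow>
           contains_copy R G1 \<or> contains_copy B G2))"

end

theory Submission
  imports Defs
begin

text \<open>
  Put \<open>k = j + 2 - m\<close> and colour an edge blue if both ends lie in the first \<open>k\<close> partite sets, red
  otherwise. If \<open>k * t < 2 * n\<close> there are too few vertices for a blue \<open>nK\<^sub>2\<close>, and a red clique has
  at most one vertex in the first \<open>k\<close> partite sets together and at most one in each of the other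
  \<open>m - 2\<close>. As the Ramsey number is a least element, one also needs that a suitable \<open>t\<close> exists: if a
  maximal blue matching has fewer than \<open>n\<close> edges and \<open>t \<ge> 2 * n\<close>, every partite set has a vertex
  missed by it, and such vertices span a red clique.
\<close>

text \<open>The condition minimised by \<open>multipartite_ramsey\<close>, without positivity of
  \<open>t\<close>.\<close>

definition multipartite_arrows :: "nat \<Rightarrow> nat \<Rightarrow> 'a ugraph \<Rightarrow> 'b ugraph \<Rightarrow> bool" where
  "multipartite_arrows j t G1 G2 \<longleftrightarrow>
     (\<forall>R B. two_edge_colouring (complete_multipartite j t) R B \<longrightarrow>
        contains_copy R G1 \<or> contains_copy B G2)"

text \<open>\<open>LEAST\<close> satisfies its defining condition only once some witness
  \<open>t\<close> is known.\<close>

lemma multipartite_ramsey_arrows: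
  assumes "t > 0" and "multipartite_arrows j t G1 G2"
  shows "multipartite_arrows j (multipartite_ramsey j G1 G2) G1 G2"
  using LeastI[of "\<lambda>t. t > 0 \<and> multipartite_arrows j t G1 G2" t] assms
  unfolding multipartite_ramsey_def multipartite_arrows_def by blast

text \<open>The new edge of \<open>matching_graph (Suc n)\<close> has ends \<open>2 * n\<close> and
  \<open>2 * n + 1\<close>; sending them to \<open>u\<close> and \<open>v\<close> keeps the map
  injective because both avoid the old image.\<close>

lemma contains_matching_Suc:
  assumes inj: "inj_on f {..<2 * n}" and verts: "f ` {..<2 * n} \<subseteq> verts G"
    and edges: "\<And>i. i < n \<Longrightarrow> {f (2 * i), f (2 * i + 1)} \<in> edges G"
    and e: "{u, v} \<in> edges G" "u \<noteq> v" "{u, v} \<subseteq> verts G" "{u, v} \<inter> f ` {..<2 * n} = {}"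
  shows "contains_copy G (matching_graph (Suc n))"
proof -
  define g where "g = f(2 * n := u, Suc (2 * n) := v)"
  have dom: "{..<2 * Suc n} = insert (Suc (2 * n)) (insert (2 * n) {..<2 * n})" by auto
  have g_old: "g x = f x" if "x < 2 * n" for x using that by (auto simp: g_def)
  have g_new: "g (2 * n) = u" "g (Suc (2 * n)) = v" by (auto simp: g_def)
  have img: "g ` {..<2 * n} = f ` {..<2 * n}" by (intro image_cong) (auto simp: g_old)
  have "inj_on g {..<2 * n}" using inj by (simp add: inj_on_def g_old)
  then have "inj_on g {..<2 * Suc n}"
    unfolding dom using e(2,4) by (auto simp: img g_new)
  moreover have "g ` {..<2 * Suc n} \<subseteq> verts G"
    unfolding dom using verts e(3) by (auto simp: g_old g_new)
  moreover have "{g (2 * i), g (2 * i + 1)} \<in> edges G" if "i < Suc n" for i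
    using that edges[of i] e(1) by (cases "i = n") (auto simp: g_old g_new)
  ultimately show ?thesis
    by (auto simp: contains_copy_def matching_graph_def)
qed

text \<open>Induction on \<open>n\<close>: the \<open>2 * n\<close> vertices of a matching either
  meet every edge or miss one, which then extends the matching. A cover found earlier stays small
  enough.\<close>

lemma matching_or_small_cover:
  assumes "simple_graph G"
  shows "contains_copy G (matching_graph n) \<or>
    (\<exists>C. finite C \<and> card C < 2 * n \<and> (\<forall>e\<in>edges G. e \<inter> C \<noteq> {}))"
proof (induction n)
  case 0
  show ?case by (simp add: contains_copy_def matching_graph_def)
next
  case (Suc n)
  then show ?case
  proof
    assume "contains_copy G (matching_graph n)"
    then obtain f where f: "inj_on f {..<2 * n}" "f ` {..<2 * n} \<subseteq> verts G"
      "\<And>e. e \<in> edges (matching_graph n) \<Longrightarrow> f ` e \<in> edges G"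
      by (auto simp: contains_copy_def matching_graph_def)
    have fe: "{f (2 * i), f (2 * i + 1)} \<in> edges G" if "i < n" for i
      using f(3)[of "{2 * i, 2 * i + 1}"] that by (auto simp: matching_graph_def)
    let ?C = "f ` {..<2 * n}"
    show ?thesis
    proof (cases "\<forall>e\<in>edges G. e \<inter> ?C \<noteq> {}")
      case True
      moreover have "card ?C < 2 * Suc n"
        using card_image_le[of "{..<2 * n}" f] by simp
      ultimately show ?thesis by blast
    next
      case False
      then obtain e where e: "e \<in> edges G" "e \<inter> ?C = {}" by blast
      moreover obtain u v where "e = {u, v}" "u \<noteq> v"
        using assms e(1) by (auto simp: simple_graph_def card_2_iff)
      moreover have "e \<subseteq> verts G" using assms e(1) by (auto simp: simple_graph_def)
      ultimately show ?thesis
        using contains_matching_Suc[OF f(1,2) fe, of u v] by simp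
    qed
  next
    assume "\<exists>C. finite C \<and> card C < 2 * n \<and> (\<forall>e\<in>edges G. e \<inter> C \<noteq> {})"
    then obtain C where "finite C" "card C < 2 * n" "\<forall>e\<in>edges G. e \<inter> C \<noteq> {}" by blast
    moreover from this have "card C < 2 * Suc n" by simp
    ultimately show ?thesis by blast
  qed
qed

lemma multipartite_arrows_clique_matching:
  assumes "m \<le> j" and "2 * n \<le> t"
  shows "multipartite_arrows j t (complete_graph m) (matching_graph n)"
  unfolding multipartite_arrows_def
proof (intro allI impI)
  fix R B assume col: "two_edge_colouring (complete_multipartite j t) R B"
  then have "simple_graph B"
    using simple_graph_complete_multipartite[of j t]
    by (auto simp: two_edge_colouring_def simple_graph_def)
  from matching_or_small_cover[OF this, of n]
  show "contains_copy R (complete_graph m) \<or> contains_copy B (matching_graph n)"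
  proof (rule disjE, goal_cases)
    case 1
    then show ?case ..
  next
    case 2
    then obtain C where C: "finite C" "card C < 2 * n" "\<forall>e\<in>edges B. e \<inter> C \<noteq> {}"
      by blast
    \<comment> \<open>\<open>C\<close> has fewer than \<open>2 * n \<le> t\<close> elements, so it
      cannot contain all of \<open>{p} \<times> {..<t}\<close>. Since \<open>p\<close> is arbitrary,
      choice gives a total function \<open>a\<close>.\<close>
    have "\<exists>a<t. (p, a) \<notin> C" for p
    proof (rule ccontr)
      assume "\<not> (\<exists>a<t. (p, a) \<notin> C)"
      then have "Pair p ` {..<t} \<subseteq> C" by auto
      from card_mono[OF C(1) this] have "t \<le> card C" by (simp add: card_image inj_on_def)
      with C(2) assms(2) show False by simp
    qed
    then obtain a where a: "\<And>p. a p < t" "\<And>p. (p, a p) \<notin> C" by metis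
    let ?f = "\<lambda>p. (p, a p)"
    have "{?f u, ?f v} \<in> edges R" if "u < m" "v < m" "u \<noteq> v" for u v
    proof -
      have "{?f u, ?f v} \<in> edges (complete_multipartite j t)"
        unfolding complete_multipartite_def snd_conv mem_Collect_eq
        using that assms(1) a(1)
        by (intro exI[of _ u] exI[of _ "a u"] exI[of _ v] exI[of _ "a v"]) auto
      moreover have "{?f u, ?f v} \<notin> edges B"
      proof
        assume "{?f u, ?f v} \<in> edges B"
        then have "{?f u, ?f v} \<inter> C \<noteq> {}" using C(3) by (rule bspec[rotated])
        then show False using a(2) by simp
      qed
      ultimately show ?thesis using col unfolding two_edge_colouring_def by blast
    qed
    moreover have "?f ` {..<m} \<subseteq> verts R"
      using col assms(1) a(1) by (auto simp: two_edge_colouring_def complete_multipartite_def)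
    ultimately have "contains_copy R (complete_graph m)"
      unfolding contains_copy_def complete_graph_def
      by (intro exI[of _ ?f]) (auto simp: inj_on_def)
    then show ?case ..
  qed
qed

text \<open>A matching has no isolated vertices: \<open>x\<close> lies on the edge with index
  \<open>x div 2\<close>. Hence all \<open>2 * n\<close> distinct images lie in
  \<open>S\<close>.\<close>

lemma matching_copy_support:
  assumes "contains_copy G (matching_graph n)" and "\<And>e. e \<in> edges G \<Longrightarrow> e \<subseteq> S" and "finite S"
  shows "2 * n \<le> card S"
proof -
  obtain f where inj: "inj_on f {..<2 * n}"
    and f: "\<And>e. e \<in> edges (matching_graph n) \<Longrightarrow> f ` e \<in> edges G"
    using assms(1) by (auto simp: contains_copy_def matching_graph_def)
  have "f x \<in> S" if "x < 2 * n" for x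
  proof -
    let ?e = "{2 * (x div 2), 2 * (x div 2) + 1}"
    have "?e \<in> edges (matching_graph n)" using that by (auto simp: matching_graph_def)
    moreover have "x \<in> ?e" by auto
    ultimately show ?thesis using f assms(2) by blast
  qed
  then have "f ` {..<2 * n} \<subseteq> S" by blast
  from card_mono[OF assms(3) this] show ?thesis using inj by (simp add: card_image)
qed

text \<open>Here \<open>c\<close> is a proper vertex colouring, so it is injective on the image of a
  clique.\<close>

lemma clique_copy_le_colours:
  assumes "contains_copy G (complete_graph m)"
    and "\<And>x y. {x, y} \<in> edges G \<Longrightarrow> c x \<noteq> c y" and "c ` verts G \<subseteq> {..<r::nat}"
  shows "m \<le> r"
proof -
  obtain f where f: "f ` {..<m} \<subseteq> verts G"
    "\<And>e. e \<in> edges (complete_graph m) \<Longrightarrow> f ` e \<in> edges G"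
    using assms(1) by (auto simp: contains_copy_def complete_graph_def)
  have "c (f u) \<noteq> c (f v)" if "u < m" "v < m" "u \<noteq> v" for u v
  proof -
    have "{u, v} \<in> edges (complete_graph m)" using that by (auto simp: complete_graph_def)
    from f(2)[OF this] have "{f u, f v} \<in> edges G" by simp
    then show ?thesis by (rule assms(2))
  qed
  then have "inj_on (c \<circ> f) {..<m}" by (auto simp: inj_on_def)
  moreover have "(c \<circ> f) ` {..<m} \<subseteq> {..<r}" using f(1) assms(3) by auto
  ultimately show ?thesis using card_inj_on_le[of "c \<circ> f" "{..<m}" "{..<r}"] by simp
qed

lemma multipartite_arrows_clique_matching_bound:
  assumes "2 \<le> m" and "m \<le> j + 1"
    and "multipartite_arrows j t (complete_graph m) (matching_graph n)"
  shows "2 * n \<le> (j + 2 - m) * t"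
proof -
  define k where "k = j + 2 - m"
  define S where "S = {..<k} \<times> {..<t}"
  let ?K = "complete_multipartite j t"
  define B where "B = (verts ?K, {e \<in> edges ?K. e \<subseteq> S})"
  define R where "R = (verts ?K, {e \<in> edges ?K. \<not> e \<subseteq> S})"
  have "two_edge_colouring ?K R B" by (auto simp: two_edge_colouring_def R_def B_def)
  with assms(3) have "contains_copy R (complete_graph m) \<or> contains_copy B (matching_graph n)"
    unfolding multipartite_arrows_def by blast
  moreover have "\<not> contains_copy R (complete_graph m)"
  proof
    assume copy: "contains_copy R (complete_graph m)"
    \<comment> \<open>a proper colouring of the red graph: the first \<open>k\<close> partite sets share colour \<open>0\<close>\<close>
    define c :: "nat \<times> nat \<Rightarrow> nat" where "c = (\<lambda>x. fst x + 1 - k)"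
    \<comment> \<open>Truncated subtraction gives colour \<open>0\<close> exactly to the parts
      \<open>p < k\<close> and distinct positive colours to the others. A red edge has an end
      outside \<open>S\<close>, so its ends never share colour \<open>0\<close>.\<close>
    have "c x \<noteq> c y" if "{x, y} \<in> edges R" for x y
      using that
      by (auto simp: R_def S_def c_def complete_multipartite_def doubleton_eq_iff)
    \<comment> \<open>The last part, \<open>j - 1\<close>, gets colour \<open>j - k = m - 2\<close>,
      so \<open>m - 1\<close> colours suffice.\<close>
    moreover have "c ` verts R \<subseteq> {..<m - 1}"
      using assms(1,2) by (auto simp: R_def c_def k_def complete_multipartite_def)
    ultimately have "m \<le> m - 1" by (rule clique_copy_le_colours[OF copy])
    with assms(1) show False by simp
  qed
  ultimately have "contains_copy B (matching_graph n)" by blast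
  then have "2 * n \<le> card S" by (rule matching_copy_support) (auto simp: B_def S_def)
  then show ?thesis by (simp add: S_def k_def)
qed

theorem theorem7:
  fixes j m n :: nat
  assumes "m \<ge> 4" and "j \<ge> m + 1" and "n \<ge> 3"
  shows "int (multipartite_ramsey j (complete_graph m) (matching_graph n))
           \<ge> \<lceil>2 * real n / (real j + 2 - real m)\<rceil>"
proof -
  let ?t = "multipartite_ramsey j (complete_graph m) (matching_graph n)"
  have "multipartite_arrows j (2 * n) (complete_graph m) (matching_graph n)"
    using assms by (intro multipartite_arrows_clique_matching) auto
  then have "multipartite_arrows j ?t (complete_graph m) (matching_graph n)"
    using assms by (intro multipartite_ramsey_arrows[of "2 * n"]) auto
  then have "2 * n \<le> (j + 2 - m) * ?t"
    using assms by (intro multipartite_arrows_clique_matching_bound) auto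
  then have "real (2 * n) \<le> real ((j + 2 - m) * ?t)" by (rule of_nat_mono)
  \<comment> \<open>Natural subtraction does not truncate here because \<open>m \<le> j\<close>, so
    it agrees with the real one.\<close>
  moreover have "real (j + 2 - m) = real j + 2 - real m" using assms by simp
  ultimately have "2 * real n \<le> real ?t * (real j + 2 - real m)"
    by (simp only: of_nat_mult of_nat_numeral mult.commute)
  moreover have "real j + 2 - real m > 0" using assms by simp
  ultimately show ?thesis by (simp add: ceiling_le_iff pos_divide_le_eq)
qed

end
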